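(* For every closed term $M$ and every value $V$: if $M\to^{*}_{\ell\cup\beta}V$ then $(\widetilde M)~\lambda x\,x\to^{=*}_{a\cup\beta}\Psi(V)$; and if $M\to^{*}_{a\cup\beta}V$ then $(\overline M)~\lambda x\,x\to^{=*}_{\ell\cup\beta}\Phi(V)$.
   Context: Fix a ring of scalars (elements $\alpha,\beta$). Terms, values and base terms are given by: $M,N,L ::= V \mid (M)~N \mid \alpha.M \mid M+N$ (terms); $U,V,W ::= 0 \mid B \mid \alpha.V \mid V+W$ (values); $B ::= x \mid \lambda x\,M$ (base terms). Terms are taken up to renaming of bound variables; $M[x:=N]$ is capture-avoiding substitution. Below $V$ is a value and $B$ a base term. Rewrite rules: $(\beta_n)$ $(\lambda x\,M)~N\to M[x:=N]$. $(A)$ $(M+N)~L\to (M)~L+(N)~L$; $(\alpha.M)~N\to\alpha.(M)~N$; $(0)~M\to 0$. $(\beta_v)$ $(\lambda x\,M)~B\to M[x:=B]$. $(A_l)$ $(M+N)~V\to(M)~V+(N)~V$; $(\alpha.M)~V\to\alpha.(M)~V$; $(0)~V\to 0$. $(A_r)$ $(B)~(M+N)\to(B)~M+(B)~N$; $(B)~(\alpha.M)\to\alpha.(B)~M$; $(B)~0\to 0$. (Asso) $M+(N+L)\to(M+N)+L$ and $(M+N)+L\to M+(N+L)$. (Com) $M+N\to N+M$. $(F)$ $\alpha.M+\beta.M\to(\alpha+\beta).M$; $\alpha.M+M\to(\alpha+1).M$; $M+M\to(1+1).M$; $\alpha.(\beta.M)\to(\alpha\beta).M$. $(S)$ $\alpha.(M+N)\to\alpha.M+\alpha.N$;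 $1.M\to M$; $0.M\to 0$; $\alpha.0\to 0$; $0+M\to M$. Context rules $(\xi)$: from $M\to M'$ infer $(M)~N\to(M')~N$, $M+N\to M'+N$, $N+M\to N+M'$, $\alpha.M\to\alpha.M'$. Context rule $(\xi_{lin})$: from $M\to M'$ infer $(V)~M\to(V)~M'$ for $V$ a value. Let $L=\mathrm{Asso}\cup\mathrm{Com}\cup F\cup S$. Define: $\to_a$ generated by $A\cup L$ closed under $\xi$; $\to_\ell$ generated by $A_l\cup A_r\cup L$ closed under $\xi,\xi_{lin}$; $\to_{\beta_v}$ generated by $\beta_v$ closed under $\xi,\xi_{lin}$; $\to_{\beta_n}$ generated by $\beta_n$ closed under $\xi$. For a relation $R$, $R^{=}$ is its symmetric closure and $R^{*}$ its reflexive-transitive closure. Set $\to_{\ell\cup\beta}:=\to_\ell\cup\to_{\beta_v}$, $\to^{=}_{\ell\cup\beta}:=(\to_\ell)^{=}\cup\to_{\beta_v}$, $\to_{a\cup\beta}:=\to_a\cup\to_{\beta_n}$, $\to^{=}_{a\cup\beta}:=(\to_a)^{=}\cup\to_{\beta_n}$. First translation (with $f,g,h$ fresh): $\widetilde{x}=\lambda f\,(f)~x$; $\widetilde{0}=0$; $\widetilde{\lambda x\,M}=\lambda f\,(f)~\lambda x\,\widetilde{M}$; $\widetilde{(M)~N}=\lambda f\,(\widetilde M)~\lambda g\,(\widetilde N)~\lambda h\,((g)~h)~f$; $\widetilde{\alpha.M}=\lambda f\,(\alpha.\widetilde M)~f$; $\widetilde{M+N}=\lambda f\,(\widetilde M+\widetilde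 N)~f$; on values $\Psi(x)=x$, $\Psi(0)=0$, $\Psi(\lambda x\,M)=\lambda x\,\widetilde M$, $\Psi(\alpha.V)=\alpha.\Psi(V)$, $\Psi(V+W)=\Psi(V)+\Psi(W)$. Second translation (with $f,g,y$ fresh): $\overline{x}=x$; $\overline{0}=\lambda f\,(0)~f$; $\overline{\lambda x\,M}=\lambda f\,(f)~\lambda x\,\overline M$; $\overline{(M)~N}=\lambda f\,(\overline M)~\lambda g\,((g)~\overline N)~f$; $\overline{\alpha.M}=\lambda f\,(\alpha.\overline M)~f$; $\overline{M+N}=\lambda f\,(\overline M+\overline N)~f$; on values $\Phi(x)=(x)~\lambda y\,y$, $\Phi(0)=0$, $\Phi(\lambda x\,M)=\lambda x\,\overline M$, $\Phi(\alpha.V)=\alpha.\Phi(V)$, $\Phi(V+W)=\Phi(V)+\Phi(W)$. *)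

theory Defs
  imports Main
begin

text \<open>
  Algebraic lambda-terms up to renaming of bound variables, represented with de Bruijn
  indices: \<open>Var i\<close> under \<open>k\<close> binders is bound if \<open>i < k\<close>, and otherwise stands for the
  \<open>(i - k)\<close>-th free variable. \<open>App M N\<close> is \<open>(M) N\<close> and \<open>Scal a M\<close> is \<open>a.M\<close>.

  The scalars form an arbitrary unital, not necessarily commutative ring. The sort
  \<open>{ring, monoid_mult}\<close> is used instead of \<open>ring_1\<close> because the latter also
  requires \<open>0 \<noteq> 1\<close>.
\<close>

datatype 's trm =
    Var nat
  | Lam "'s trm"
  | App "'s trm" "'s trm"
  | Zero
  | Scal 's "'s trm"
  | Plus "'s trm" "'s trm"

inductive is_base :: "'s trm \<Rightarrow> bool" where
  "is_base (Var i)"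
| "is_base (Lam M)"

inductive is_value :: "'s trm \<Rightarrow> bool" where
  "is_value Zero"
| "is_base B \<Longrightarrow> is_value B"
| "is_value V \<Longrightarrow> is_value (Scal a V)"
| "is_value V \<Longrightarrow> is_value W \<Longrightarrow> is_value (Plus V W)"

primrec fv :: "'s trm \<Rightarrow> nat set" where
  "fv (Var i) = {i}"
| "fv (Lam M) = {i. Suc i \<in> fv M}"
| "fv (App M N) = fv M \<union> fv N"
| "fv Zero = {}"
| "fv (Scal a M) = fv M"
| "fv (Plus M N) = fv M \<union> fv N"

definition closed_trm :: "'s trm \<Rightarrow> bool" where
  "closed_trm M \<longleftrightarrow> fv M = {}"

text \<open>
  \<open>lift k M\<close> makes room for one new variable at index \<open>k\<close>, i.e. it places \<open>M\<close> in the scope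
  of a binder whose variable is fresh for \<open>M\<close>.
\<close>

primrec lift :: "nat \<Rightarrow> 's trm \<Rightarrow> 's trm" where
  "lift k (Var i) = (if i < k then Var i else Var (Suc i))"
| "lift k (Lam M) = Lam (lift (Suc k) M)"
| "lift k (App M N) = App (lift k M) (lift k N)"
| "lift k Zero = Zero"
| "lift k (Scal a M) = Scal a (lift k M)"
| "lift k (Plus M N) = Plus (lift k M) (lift k N)"

text \<open>
  \<open>subst M k N\<close> replaces variable \<open>k\<close> of \<open>M\<close> by \<open>N\<close> and removes the index \<open>k\<close>; if \<open>M\<close> is the
  body of an abstraction over \<open>x\<close>, then \<open>subst M 0 N\<close> is \<open>M[x := N]\<close>.
\<close>

primrec subst :: "'s trm \<Rightarrow> nat \<Rightarrow> 's trm \<Rightarrow> 's trm" where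
  "subst (Var i) k N = (if i < k then Var i else if i = k then N else Var (i - 1))"
| "subst (Lam M) k N = Lam (subst M (Suc k) (lift 0 N))"
| "subst (App M L) k N = App (subst M k N) (subst L k N)"
| "subst Zero k N = Zero"
| "subst (Scal a M) k N = Scal a (subst M k N)"
| "subst (Plus M L) k N = Plus (subst M k N) (subst L k N)"


inductive_set rule_beta_n :: "('s trm \<times> 's trm) set" where
  "(App (Lam M) N, subst M 0 N) \<in> rule_beta_n"

inductive_set rule_beta_v :: "('s trm \<times> 's trm) set" where
  "is_base B \<Longrightarrow> (App (Lam M) B, subst M 0 B) \<in> rule_beta_v"

inductive_set rule_A :: "('s trm \<times> 's trm) set" where
  "(App (Plus M N) L, Plus (App M L) (App N L)) \<in> rule_A"
| "(App (Scal a M) N, Scal a (App M N)) \<in> rule_A"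
| "(App Zero M, Zero) \<in> rule_A"

inductive_set rule_Al :: "('s trm \<times> 's trm) set" where
  "is_value V \<Longrightarrow> (App (Plus M N) V, Plus (App M V) (App N V)) \<in> rule_Al"
| "is_value V \<Longrightarrow> (App (Scal a M) V, Scal a (App M V)) \<in> rule_Al"
| "is_value V \<Longrightarrow> (App Zero V, Zero) \<in> rule_Al"

inductive_set rule_Ar :: "('s trm \<times> 's trm) set" where
  "is_base B \<Longrightarrow> (App B (Plus M N), Plus (App B M) (App B N)) \<in> rule_Ar"
| "is_base B \<Longrightarrow> (App B (Scal a M), Scal a (App B M)) \<in> rule_Ar"
| "is_base B \<Longrightarrow> (App B Zero, Zero) \<in> rule_Ar"

inductive_set rule_Asso :: "('s trm \<times> 's trm) set" where
  "(Plus M (Plus N L), Plus (Plus M N) L) \<in> rule_Asso"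
| "(Plus (Plus M N) L, Plus M (Plus N L)) \<in> rule_Asso"

inductive_set rule_Com :: "('s trm \<times> 's trm) set" where
  "(Plus M N, Plus N M) \<in> rule_Com"

inductive_set rule_F :: "('s::{ring,monoid_mult} trm \<times> 's trm) set" where
  "(Plus (Scal a M) (Scal b M), Scal (a + b) M) \<in> rule_F"
| "(Plus (Scal a M) M, Scal (a + 1) M) \<in> rule_F"
| "(Plus M M, Scal (1 + 1) M) \<in> rule_F"
| "(Scal a (Scal b M), Scal (a * b) M) \<in> rule_F"

inductive_set rule_S :: "('s::{ring,monoid_mult} trm \<times> 's trm) set" where
  "(Scal a (Plus M N), Plus (Scal a M) (Scal a N)) \<in> rule_S"
| "(Scal 1 M, M) \<in> rule_S"
| "(Scal 0 M, Zero) \<in> rule_S"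
| "(Scal a Zero, Zero) \<in> rule_S"
| "(Plus Zero M, M) \<in> rule_S"

definition rule_L :: "('s::{ring,monoid_mult} trm \<times> 's trm) set" where
  "rule_L = rule_Asso \<union> rule_Com \<union> rule_F \<union> rule_S"


inductive_set ctx_xi :: "('s trm \<times> 's trm) set \<Rightarrow> ('s trm \<times> 's trm) set"
  for R :: "('s trm \<times> 's trm) set" where
  "(M, M') \<in> R \<Longrightarrow> (M, M') \<in> ctx_xi R"
| "(M, M') \<in> ctx_xi R \<Longrightarrow> (App M N, App M' N) \<in> ctx_xi R"
| "(M, M') \<in> ctx_xi R \<Longrightarrow> (Plus M N, Plus M' N) \<in> ctx_xi R"
| "(M, M') \<in> ctx_xi R \<Longrightarrow> (Plus N M, Plus N M') \<in> ctx_xi R"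
| "(M, M') \<in> ctx_xi R \<Longrightarrow> (Scal a M, Scal a M') \<in> ctx_xi R"

inductive_set ctx_xi_lin :: "('s trm \<times> 's trm) set \<Rightarrow> ('s trm \<times> 's trm) set"
  for R :: "('s trm \<times> 's trm) set" where
  "(M, M') \<in> R \<Longrightarrow> (M, M') \<in> ctx_xi_lin R"
| "(M, M') \<in> ctx_xi_lin R \<Longrightarrow> (App M N, App M' N) \<in> ctx_xi_lin R"
| "(M, M') \<in> ctx_xi_lin R \<Longrightarrow> (Plus M N, Plus M' N) \<in> ctx_xi_lin R"
| "(M, M') \<in> ctx_xi_lin R \<Longrightarrow> (Plus N M, Plus N M') \<in> ctx_xi_lin R"
| "(M, M') \<in> ctx_xi_lin R \<Longrightarrow> (Scal a M, Scal a M') \<in> ctx_xi_lin R"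
| "is_value V \<Longrightarrow> (M, M') \<in> ctx_xi_lin R \<Longrightarrow> (App V M, App V M') \<in> ctx_xi_lin R"


definition red_a :: "('s::{ring,monoid_mult} trm \<times> 's trm) set" where
  "red_a = ctx_xi (rule_A \<union> rule_L)"

definition red_l :: "('s::{ring,monoid_mult} trm \<times> 's trm) set" where
  "red_l = ctx_xi_lin (rule_Al \<union> rule_Ar \<union> rule_L)"

definition red_beta_n :: "('s trm \<times> 's trm) set" where
  "red_beta_n = ctx_xi rule_beta_n"

definition red_beta_v :: "('s trm \<times> 's trm) set" where
  "red_beta_v = ctx_xi_lin rule_beta_v"

definition red_l_beta :: "('s::{ring,monoid_mult} trm \<times> 's trm) set" where
  "red_l_beta = red_l \<union> red_beta_v"

definition red_a_beta :: "('s::{ring,monoid_mult} trm \<times> 's trm) set" where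
  "red_a_beta = red_a \<union> red_beta_n"

text \<open>In the following two relations only the algebraic part is symmetric.\<close>

definition red_l_beta_eq :: "('s::{ring,monoid_mult} trm \<times> 's trm) set" where
  "red_l_beta_eq = (red_l \<union> red_l\<inverse>) \<union> red_beta_v"

definition red_a_beta_eq :: "('s::{ring,monoid_mult} trm \<times> 's trm) set" where
  "red_a_beta_eq = (red_a \<union> red_a\<inverse>) \<union> red_beta_n"


text \<open>
  In the translations, each subterm is lifted once for every fresh variable in whose scope it
  is placed. In the abstraction case the body ends up below \<open>f\<close> and then \<open>x\<close>, so its index 0
  (for \<open>x\<close>) is kept and the new index 1 is that of \<open>f\<close>. In the application cases the indices
  of \<open>f\<close>, \<open>g\<close>, \<open>h\<close> below all binders are 2, 1, 0 (first translation) and those of \<open>f\<close>, \<open>g\<close>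
  are 1, 0 (second translation).
\<close>

primrec tilde :: "'s trm \<Rightarrow> 's trm" where
  "tilde (Var i) = Lam (App (Var 0) (Var (Suc i)))"
| "tilde Zero = Zero"
| "tilde (Lam M) = Lam (App (Var 0) (Lam (lift 1 (tilde M))))"
| "tilde (App M N) =
     Lam (App (lift 0 (tilde M))
       (Lam (App (lift 0 (lift 0 (tilde N)))
          (Lam (App (App (Var 1) (Var 0)) (Var 2))))))"
| "tilde (Scal a M) = Lam (App (Scal a (lift 0 (tilde M))) (Var 0))"
| "tilde (Plus M N) = Lam (App (Plus (lift 0 (tilde M)) (lift 0 (tilde N))) (Var 0))"

primrec bar :: "'s trm \<Rightarrow> 's trm" where
  "bar (Var i) = Var i"
| "bar Zero = Lam (App Zero (Var 0))"
| "bar (Lam M) = Lam (App (Var 0) (Lam (lift 1 (bar M))))"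
| "bar (App M N) =
     Lam (App (lift 0 (bar M))
       (Lam (App (App (Var 0) (lift 0 (lift 0 (bar N)))) (Var 1))))"
| "bar (Scal a M) = Lam (App (Scal a (lift 0 (bar M))) (Var 0))"
| "bar (Plus M N) = Lam (App (Plus (lift 0 (bar M)) (lift 0 (bar N))) (Var 0))"

text \<open>
  The maps on values are meaningful only for terms satisfying \<^const>\<open>is_value\<close>; the result
  on applications is left unspecified.
\<close>

primrec Psi :: "'s trm \<Rightarrow> 's trm" where
  "Psi (Var i) = Var i"
| "Psi Zero = Zero"
| "Psi (Lam M) = Lam (tilde M)"
| "Psi (Scal a V) = Scal a (Psi V)"
| "Psi (Plus V W) = Plus (Psi V) (Psi W)"
| "Psi (App M N) = undefined"

primrec Phi :: "'s trm \<Rightarrow> 's trm" where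
  "Phi (Var i) = App (Var i) (Lam (Var 0))"
| "Phi Zero = Zero"
| "Phi (Lam M) = Lam (bar M)"
| "Phi (Scal a V) = Scal a (Phi V)"
| "Phi (Plus V W) = Plus (Phi V) (Phi W)"
| "Phi (App M N) = undefined"

end

theory Submission
  imports Defs
begin

text \<open>
  Plotkin's colon translation: \<open>M : K\<close> is the reduct of the translation of \<open>M\<close> applied to
  the continuation \<open>K\<close> from which the administrative redexes of the translation are gone.
  A source step \<open>M \<rightarrow> M'\<close> becomes \<open>M : K \<rightarrow>\<^sup>* M' : K\<close>, and \<open>V : \<lambda>x x\<close> reduces to the image of
  the value \<open>V\<close>. For algebraic terms one must make \<open>(M) N : K\<close> linear in the function \<open>M\<close>
  whatever \<open>N\<close> is: if \<open>(U) N : K\<close> were \<open>N : \<lambda>h ((\<Psi>(U)) h) K\<close> for a sum \<open>U\<close>, comparing it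
  with \<open>U : \<lambda>g \<dots>\<close> would require distributing a sum below an abstraction.
  With this choice forward steps suffice, so no algebraic step is ever reversed.
\<close>

section \<open>Lifting and substitution\<close>

lemma lift_lift: "i \<le> j \<Longrightarrow> lift i (lift j M) = lift (Suc j) (lift i M)"
  by (induction M arbitrary: i j) auto

lemma subst_lift [simp]: "subst (lift k M) k N = M"
  by (induction M arbitrary: k N) auto

text \<open>Needed to compute beta steps under the binders \<open>f\<close>, \<open>g\<close>,
  \<open>h\<close> that the translations add.\<close>

lemma subst_lift_le:
  "i \<le> k \<Longrightarrow> subst (lift i M) (Suc k) (lift i N) = lift i (subst M k N)"
  by (induction M arbitrary: i k N) (auto simp: lift_lift)

lemma is_base_iff: "is_base B \<longleftrightarrow> (\<exists>i. B = Var i) \<or> (\<exists>M. B = Lam M)"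
  by (auto elim: is_base.cases intro: is_base.intros)

lemma tilde_lift: "tilde (lift k M) = lift k (tilde M)"
  by (induction M arbitrary: k) (auto simp: lift_lift)

lemma Psi_lift: "is_base B \<Longrightarrow> Psi (lift k B) = lift k (Psi B)"
  by (auto simp: is_base_iff tilde_lift)

lemma is_base_lift: "is_base B \<Longrightarrow> is_base (lift k B)"
  by (auto simp: is_base_iff)

lemma tilde_base: "is_base B \<Longrightarrow> tilde B = Lam (App (Var 0) (lift 0 (Psi B)))"
  by (auto simp: is_base_iff)

text \<open>Substituting \<open>Psi B\<close> for \<open>x\<close> in
  \<open>\<lambda>f (f) x\<close> yields \<open>tilde B\<close> by \<open>tilde_base\<close>; this
  is where \<open>B\<close> has to be a base term.\<close>

lemma tilde_subst:
  "is_base B \<Longrightarrow> tilde (subst M k B) = subst (tilde M) k (Psi B)"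
proof (induction M arbitrary: k B)
  case (Lam M)
  then show ?case
    \<comment> \<open>Index 1 is the slot that \<open>tilde\<close> inserts for \<open>f\<close> in
      the body of the abstraction.\<close>
    using subst_lift_le[of 1 "Suc k" "tilde M" "lift 0 (Psi B)"]
    by (auto simp: is_base_lift Psi_lift lift_lift)
qed (auto simp: subst_lift_le tilde_base)

lemma bar_lift: "bar (lift k M) = lift k (bar M)"
  by (induction M arbitrary: k) (auto simp: lift_lift)

lemma bar_subst: "bar (subst M k N) = subst (bar M) k (bar N)"
proof (induction M arbitrary: k N)
  case (Lam M)
  then show ?case
    using subst_lift_le[of 1 "Suc k" "bar M" "lift 0 (bar N)"]
    by (auto simp: bar_lift lift_lift)
qed (auto simp: subst_lift_le bar_lift)

text \<open>Hence any translated argument may be passed by \<open>rule_beta_v\<close>.\<close>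

lemma is_base_bar: "is_base (bar M)"
  by (cases M) (auto simp: is_base_iff)

section \<open>Evaluation contexts\<close>

text \<open>Collects the rules common to \<open>ctx_xi\<close> and \<open>ctx_xi_lin\<close>, so
  that one passage to the closure serves both target calculi.\<close>

definition xi_closed :: "('s trm \<times> 's trm) set \<Rightarrow> bool" where
  "xi_closed R \<longleftrightarrow> (\<forall>M M'. (M, M') \<in> R \<longrightarrow>
     (\<forall>N. (App M N, App M' N) \<in> R \<and> (Plus M N, Plus M' N) \<in> R \<and> (Plus N M, Plus N M') \<in> R)
     \<and> (\<forall>a. (Scal a M, Scal a M') \<in> R))"

lemma xi_closed_rtrancl: "xi_closed R \<Longrightarrow> xi_closed (R\<^sup>*)"
  unfolding xi_closed_def
proof (intro allI impI)
  fix M M'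
  assume c: "\<forall>M M'. (M, M') \<in> R \<longrightarrow>
     (\<forall>N. (App M N, App M' N) \<in> R \<and> (Plus M N, Plus M' N) \<in> R \<and> (Plus N M, Plus N M') \<in> R)
     \<and> (\<forall>a. (Scal a M, Scal a M') \<in> R)"
  assume "(M, M') \<in> R\<^sup>*"
  then show "(\<forall>N. (App M N, App M' N) \<in> R\<^sup>* \<and> (Plus M N, Plus M' N) \<in> R\<^sup>* \<and>
      (Plus N M, Plus N M') \<in> R\<^sup>*) \<and> (\<forall>a. (Scal a M, Scal a M') \<in> R\<^sup>*)"
    by induction (use c in \<open>auto intro: rtrancl_into_rtrancl\<close>)
qed

lemma xi_closed_red_a_beta: "xi_closed red_a_beta"
  by (auto simp: xi_closed_def red_a_beta_def red_a_def red_beta_n_def intro: ctx_xi.intros)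

lemma xi_closed_red_l_beta: "xi_closed red_l_beta"
  by (auto simp: xi_closed_def red_l_beta_def red_l_def red_beta_v_def intro: ctx_xi_lin.intros)

lemma xi_closed_App: "xi_closed R \<Longrightarrow> (M, M') \<in> R \<Longrightarrow> (App M N, App M' N) \<in> R"
  and xi_closed_Scal: "xi_closed R \<Longrightarrow> (M, M') \<in> R \<Longrightarrow> (Scal a M, Scal a M') \<in> R"
  by (auto simp: xi_closed_def)

lemma xi_closed_Plus:
  assumes "xi_closed R" "(M, M') \<in> R\<^sup>*" "(N, N') \<in> R\<^sup>*"
  shows "(Plus M N, Plus M' N') \<in> R\<^sup>*"
proof (rule rtrancl_trans)
  note c = xi_closed_rtrancl[OF assms(1)]
  show "(Plus M N, Plus M' N) \<in> R\<^sup>*" "(Plus M' N, Plus M' N') \<in> R\<^sup>*"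
    using c assms(2,3) unfolding xi_closed_def by blast+
qed

abbreviation (input) red_n :: "'s::{ring,monoid_mult} trm \<Rightarrow> 's trm \<Rightarrow> bool" (infix "\<rightarrow>n" 50) where
  "M \<rightarrow>n N \<equiv> (M, N) \<in> red_a_beta\<^sup>*"

abbreviation (input) red_v :: "'s::{ring,monoid_mult} trm \<Rightarrow> 's trm \<Rightarrow> bool" (infix "\<rightarrow>v" 50) where
  "M \<rightarrow>v N \<equiv> (M, N) \<in> red_l_beta\<^sup>*"

lemmas red_n_App = xi_closed_App[OF xi_closed_rtrancl[OF xi_closed_red_a_beta]]
lemmas red_n_Scal = xi_closed_Scal[OF xi_closed_rtrancl[OF xi_closed_red_a_beta]]
lemmas red_n_Plus = xi_closed_Plus[OF xi_closed_red_a_beta]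
lemmas red_v_App = xi_closed_App[OF xi_closed_rtrancl[OF xi_closed_red_l_beta]]
lemmas red_v_Scal = xi_closed_Scal[OF xi_closed_rtrancl[OF xi_closed_red_l_beta]]
lemmas red_v_Plus = xi_closed_Plus[OF xi_closed_red_l_beta]

lemma red_n_beta: "subst M 0 N = P \<Longrightarrow> App (Lam M) N \<rightarrow>n P"
  by (auto simp: red_a_beta_def red_beta_n_def intro: ctx_xi.intros rule_beta_n.intros)

lemma red_n_A: "(M, N) \<in> rule_A \<Longrightarrow> M \<rightarrow>n N"
  by (auto simp: red_a_beta_def red_a_def intro: ctx_xi.intros)

lemma red_n_L: "(M, N) \<in> rule_L \<Longrightarrow> M \<rightarrow>n N"
  by (auto simp: red_a_beta_def red_a_def intro: ctx_xi.intros)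

lemma red_v_beta: "is_base N \<Longrightarrow> subst M 0 N = P \<Longrightarrow> App (Lam M) N \<rightarrow>v P"
  by (auto simp: red_l_beta_def red_beta_v_def intro: ctx_xi_lin.intros rule_beta_v.intros)

lemma red_v_Al: "(M, N) \<in> rule_Al \<Longrightarrow> M \<rightarrow>v N"
  by (auto simp: red_l_beta_def red_l_def intro: ctx_xi_lin.intros)

lemma red_v_L: "(M, N) \<in> rule_L \<Longrightarrow> M \<rightarrow>v N"
  by (auto simp: red_l_beta_def red_l_def intro: ctx_xi_lin.intros)

text \<open>
  \<open>rule_L\<close> is a set of equation schemes in \<open>+\<close>, \<open>0\<close> and scaling over metavariables, hence
  it is preserved by every map that is linear in these operations.
\<close>

lemma rule_L_linear:
  assumes "(M, N) \<in> rule_L" "f Zero = Zero"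
    and "\<And>a M. f (Scal a M) = Scal a (f M)"
    and "\<And>M N. f (Plus M N) = Plus (f M) (f N)"
  shows "(f M, f N) \<in> rule_L"
  using assms(1) unfolding rule_L_def
  by (auto elim!: rule_Asso.cases rule_Com.cases rule_F.cases rule_S.cases
      simp: assms(2-) intro: rule_Asso.intros rule_Com.intros rule_F.intros rule_S.intros)

section \<open>Call-by-name simulates call-by-value\<close>

text \<open>\<open>arg_cont\<close> awaits the value of the argument of \<open>B\<close>;
  \<open>fun_cont\<close> awaits the value of a function whose argument \<open>N\<close> is still
  unevaluated.\<close>

abbreviation (input) arg_cont :: "'s trm \<Rightarrow> 's trm \<Rightarrow> 's trm" where
  "arg_cont B K \<equiv> Lam (App (App (lift 0 (Psi B)) (Var 0)) (lift 0 K))"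

abbreviation (input) fun_cont :: "'s trm \<Rightarrow> 's trm \<Rightarrow> 's trm" where
  "fun_cont N K \<equiv> Lam (App (lift 0 (tilde N))
     (Lam (App (App (Var 1) (Var 0)) (lift 0 (lift 0 K)))))"

text \<open>\<open>colon_n M K\<close> is \<open>M : K\<close>, and \<open>colon_n_app M N K\<close> is \<open>(M) N : K\<close> by cases on \<open>M\<close>.\<close>

function colon_n :: "'s trm \<Rightarrow> 's trm \<Rightarrow> 's trm"
  and colon_n_app :: "'s trm \<Rightarrow> 's trm \<Rightarrow> 's trm \<Rightarrow> 's trm" where
  "colon_n (Var i) K = App K (Psi (Var i))"
| "colon_n (Lam M) K = App K (Psi (Lam M))"
| "colon_n Zero K = Zero"
| "colon_n (Scal a M) K = Scal a (colon_n M K)"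
| "colon_n (Plus M N) K = Plus (colon_n M K) (colon_n N K)"
| "colon_n (App M N) K = colon_n_app M N K"
| "colon_n_app (Var i) N K = colon_n N (arg_cont (Var i) K)"
| "colon_n_app (Lam M) N K = colon_n N (arg_cont (Lam M) K)"
| "colon_n_app Zero N K = Zero"
| "colon_n_app (Scal a M) N K = Scal a (colon_n_app M N K)"
| "colon_n_app (Plus M M') N K = Plus (colon_n_app M N K) (colon_n_app M' N K)"
| "colon_n_app (App M M') N K = colon_n (App M M') (fun_cont N K)"
  by pat_completeness auto
termination
  \<comment> \<open>Doubling makes the constructor \<open>App\<close> outweigh the offset 2 of
    \<open>colon_n_app\<close>; the offset 1 keeps the call back to \<open>colon_n\<close> smaller
    even for an argument of size 0.\<close>
  by (relation "measure (case_sum (\<lambda>(M, K). 2 * size M + 1) (\<lambda>(M, N, K). 2 * size M + 2 * size N + 2))")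
    auto

lemma colon_n_base:
  "is_base B \<Longrightarrow> colon_n B K = App K (Psi B)"
  "is_base B \<Longrightarrow> colon_n_app B N K = colon_n N (arg_cont B K)"
  by (auto simp: is_base_iff)

lemma fun_cont_base:
  assumes "App (tilde N) (arg_cont B K) \<rightarrow>n colon_n N (arg_cont B K)"
  shows "App (fun_cont N K) (Psi B) \<rightarrow>n colon_n N (arg_cont B K)"
  by (rule rtrancl_trans[OF red_n_beta assms]) (simp add: subst_lift_le)

text \<open>Both sides are linear in \<open>M\<close> and coincide on applications, so only base
  terms need steps. The assumption on \<open>N\<close> is an induction hypothesis when this is used
  for \<open>tilde_colon_n\<close>.\<close>

lemma colon_n_fun_cont:
  assumes "\<And>K. App (tilde N) K \<rightarrow>n colon_n N K"
  shows "colon_n M (fun_cont N K) \<rightarrow>n colon_n_app M N K"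
proof (induction M)
  case (Var i)
  show ?case
    unfolding colon_n.simps colon_n_app.simps by (intro fun_cont_base assms)
next
  case (Lam M)
  show ?case
    unfolding colon_n.simps colon_n_app.simps by (intro fun_cont_base assms)
qed (auto intro: red_n_Scal red_n_Plus)

lemma tilde_colon_n: "App (tilde M) K \<rightarrow>n colon_n M K"
proof (induction M arbitrary: K)
  case (Var i)
  then show ?case by (auto intro: red_n_beta)
next
  case (Lam M)
  then show ?case by (auto intro: red_n_beta)
next
  case (App M N)
  have "App (tilde (App M N)) K \<rightarrow>n App (tilde M) (fun_cont N K)"
    unfolding tilde.simps by (rule red_n_beta) (simp add: subst_lift_le)
  also have "App (tilde M) (fun_cont N K) \<rightarrow>n colon_n M (fun_cont N K)"
    by (rule App)
  also have "colon_n M (fun_cont N K) \<rightarrow>n colon_n_app M N K"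
    by (intro colon_n_fun_cont App)
  finally show ?case by simp
next
  case Zero
  then show ?case by (auto intro: red_n_A rule_A.intros)
next
  case (Scal a M)
  have "App (tilde (Scal a M)) K \<rightarrow>n App (Scal a (tilde M)) K"
    unfolding tilde.simps by (rule red_n_beta) simp
  also have "App (Scal a (tilde M)) K \<rightarrow>n Scal a (App (tilde M) K)"
    by (intro red_n_A rule_A.intros)
  also have "Scal a (App (tilde M) K) \<rightarrow>n Scal a (colon_n M K)"
    by (intro red_n_Scal Scal)
  finally show ?case by simp
next
  case (Plus M N)
  have "App (tilde (Plus M N)) K \<rightarrow>n App (Plus (tilde M) (tilde N)) K"
    unfolding tilde.simps by (rule red_n_beta) simp
  also have "App (Plus (tilde M) (tilde N)) K \<rightarrow>n Plus (App (tilde M) K) (App (tilde N) K)"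
    by (intro red_n_A rule_A.intros)
  also have "Plus (App (tilde M) K) (App (tilde N) K) \<rightarrow>n Plus (colon_n M K) (colon_n N K)"
    by (intro red_n_Plus Plus)
  finally show ?case by simp
qed

lemma colon_n_beta:
  assumes "is_base B"
  shows "colon_n (App (Lam P) B) K \<rightarrow>n colon_n (subst P 0 B) K"
proof -
  have "colon_n (App (Lam P) B) K \<rightarrow>n App (App (Lam (tilde P)) (Psi B)) K"
    using assms by (auto simp: colon_n_base(1) intro: red_n_beta)
  also have "App (App (Lam (tilde P)) (Psi B)) K \<rightarrow>n App (tilde (subst P 0 B)) K"
    using assms by (intro red_n_App red_n_beta) (simp add: tilde_subst)
  also have "App (tilde (subst P 0 B)) K \<rightarrow>n colon_n (subst P 0 B) K"
    by (rule tilde_colon_n)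
  finally show ?thesis .
qed

text \<open>The second conjunct handles steps in function position: \<open>(M) N : K\<close> depends
  on the shape of \<open>M\<close>, which a step may change.\<close>

definition sim_n :: "'s::{ring,monoid_mult} trm \<Rightarrow> 's trm \<Rightarrow> bool" where
  "sim_n M M' \<longleftrightarrow> (\<forall>K. colon_n M K \<rightarrow>n colon_n M' K) \<and>
     (\<forall>N K. colon_n_app M N K \<rightarrow>n colon_n_app M' N K)"

text \<open>On an application \<open>colon_n_app\<close> is \<open>colon_n\<close> with a
  \<open>fun_cont\<close>; \<open>colon_n_fun_cont\<close> then adapts the result to the shape of
  \<open>M'\<close>.\<close>

lemma sim_n_App:
  assumes "\<And>K. colon_n (App M N) K \<rightarrow>n colon_n M' K"
  shows "sim_n (App M N) M'"
  unfolding sim_n_def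
proof (intro conjI allI)
  fix L K
  have "colon_n (App M N) (fun_cont L K) \<rightarrow>n colon_n M' (fun_cont L K)"
    by (rule assms)
  also have "colon_n M' (fun_cont L K) \<rightarrow>n colon_n_app M' L K"
    by (rule colon_n_fun_cont[OF tilde_colon_n])
  finally show "colon_n_app (App M N) L K \<rightarrow>n colon_n_app M' L K"
    by simp
qed (rule assms)

text \<open>\<open>rule_Al\<close> and \<open>rule_Ar\<close> leave the colon term unchanged, as
  \<open>colon_n_app\<close> is linear in the function and, for a base function, in the
  argument.\<close>

lemma sim_n_rule:
  assumes "(M, M') \<in> rule_Al \<union> rule_Ar \<union> rule_L \<union> rule_beta_v"
  shows "sim_n M M'"
  using assms
proof (elim UnE)
  assume "(M, M') \<in> rule_L"
  then show ?thesis
    unfolding sim_n_def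
    by (auto intro!: red_n_L rule_L_linear[where f = "\<lambda>M. colon_n M K" for K]
        rule_L_linear[where f = "\<lambda>M. colon_n_app M N K" for N K])
next
  assume "(M, M') \<in> rule_beta_v"
  then show ?thesis by (auto elim!: rule_beta_v.cases intro!: sim_n_App colon_n_beta)
qed (auto elim!: rule_Al.cases rule_Ar.cases intro!: sim_n_App simp: colon_n_base(2))

text \<open>A value is a linear combination of base terms, and under each of these \<open>M\<close>
  is evaluated by \<open>colon_n\<close>.\<close>

lemma colon_n_app_arg:
  assumes "is_value V" "\<And>K. colon_n M K \<rightarrow>n colon_n M' K"
  shows "colon_n_app V M K \<rightarrow>n colon_n_app V M' K"
  using assms(1)
  by induction (auto simp: colon_n_base assms(2) intro: red_n_Scal red_n_Plus)

lemma sim_n_ctx: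
  assumes "(M, M') \<in> ctx_xi_lin R" "\<And>M M'. (M, M') \<in> R \<Longrightarrow> sim_n M M'"
  shows "sim_n M M'"
  using assms(1)
proof induction
  case (2 M M' N)
  then show ?case by (intro sim_n_App) (auto simp: sim_n_def)
next
  case (6 V M M')
  then show ?case by (intro sim_n_App) (auto simp: sim_n_def intro: colon_n_app_arg)
qed (auto simp: assms(2), auto simp: sim_n_def intro: red_n_Scal red_n_Plus)

lemma colon_n_red:
  assumes "M \<rightarrow>v N"
  shows "colon_n M K \<rightarrow>n colon_n N K"
  using assms
proof induction
  case (step N L)
  from step(2) have "sim_n N L"
    unfolding red_l_beta_def red_l_def red_beta_v_def
    by (rule UnE) (erule sim_n_ctx, blast intro: sim_n_rule)+
  then have "colon_n N K \<rightarrow>n colon_n L K"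
    by (simp add: sim_n_def)
  with step(3) show ?case by (rule rtrancl_trans)
qed simp

lemma colon_n_value:
  assumes "is_value V"
  shows "colon_n V (Lam (Var 0)) \<rightarrow>n Psi V"
  using assms
proof induction
  case (2 B)
  then show ?case by (auto simp: colon_n_base intro: red_n_beta)
qed (auto intro: red_n_Scal red_n_Plus)

section \<open>Call-by-value simulates call-by-name\<close>

abbreviation (input) app_cont :: "'s trm \<Rightarrow> 's trm \<Rightarrow> 's trm" where
  "app_cont N K \<equiv> Lam (App (App (Var 0) (lift 0 (bar N))) (lift 0 K))"

text \<open>A variable stands for a suspended computation, so \<open>x : K\<close> runs it on
  \<open>K\<close>; arguments occur only suspended, as \<open>bar N\<close>.\<close>

function colon_v :: "'s trm \<Rightarrow> 's trm \<Rightarrow> 's trm"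
  and colon_v_app :: "'s trm \<Rightarrow> 's trm \<Rightarrow> 's trm \<Rightarrow> 's trm" where
  "colon_v (Var i) K = App (Var i) K"
| "colon_v (Lam M) K = App K (Lam (bar M))"
| "colon_v Zero K = Zero"
| "colon_v (Scal a M) K = Scal a (colon_v M K)"
| "colon_v (Plus M N) K = Plus (colon_v M K) (colon_v N K)"
| "colon_v (App M N) K = colon_v_app M N K"
| "colon_v_app (Var i) N K = App (Var i) (app_cont N K)"
| "colon_v_app (Lam M) N K = App (App (Lam (bar M)) (bar N)) K"
| "colon_v_app Zero N K = Zero"
| "colon_v_app (Scal a M) N K = Scal a (colon_v_app M N K)"
| "colon_v_app (Plus M M') N K = Plus (colon_v_app M N K) (colon_v_app M' N K)"
| "colon_v_app (App M M') N K = colon_v (App M M') (app_cont N K)"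
  by pat_completeness auto
termination
  by (relation "measure (case_sum (\<lambda>(M, K). 2 * size M + 1) (\<lambda>(M, N, K). 2 * size M + 2 * size N + 2))")
    auto

lemma colon_v_app_cont: "colon_v M (app_cont N K) \<rightarrow>v colon_v_app M N K"
proof (induction M)
  case (Lam M)
  show ?case by (auto intro!: red_v_beta is_base.intros)
qed (auto intro: red_v_Scal red_v_Plus)

text \<open>\<open>K\<close> is a base term so that \<open>rule_beta_v\<close> and
  \<open>rule_Al\<close> can fire on it; the continuations built here are abstractions.\<close>

lemma bar_colon_v: "is_base K \<Longrightarrow> App (bar M) K \<rightarrow>v colon_v M K"
proof (induction M arbitrary: K)
  case (Var i)
  then show ?case by simp
next
  case (Lam M)
  then show ?case by (auto intro: red_v_beta)
next
  case (App M N)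
  have "App (bar (App M N)) K \<rightarrow>v App (bar M) (app_cont N K)"
    unfolding bar.simps using App.prems by (intro red_v_beta) (simp_all add: subst_lift_le)
  also have "App (bar M) (app_cont N K) \<rightarrow>v colon_v M (app_cont N K)"
    by (intro App is_base.intros)
  also have "colon_v M (app_cont N K) \<rightarrow>v colon_v_app M N K"
    by (rule colon_v_app_cont)
  finally show ?case by simp
next
  case Zero
  have "App (bar Zero) K \<rightarrow>v App Zero K"
    unfolding bar.simps using Zero by (intro red_v_beta) simp_all
  also have "App Zero K \<rightarrow>v Zero"
    using Zero by (intro red_v_Al rule_Al.intros is_value.intros)
  finally show ?case by simp
next
  case (Scal a M)
  have "App (bar (Scal a M)) K \<rightarrow>v App (Scal a (bar M)) K"
    unfolding bar.simps using Scal.prems by (intro red_v_beta) simp_all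
  also have "App (Scal a (bar M)) K \<rightarrow>v Scal a (App (bar M) K)"
    using Scal.prems by (intro red_v_Al rule_Al.intros is_value.intros)
  also have "Scal a (App (bar M) K) \<rightarrow>v Scal a (colon_v M K)"
    by (intro red_v_Scal Scal)
  finally show ?case by simp
next
  case (Plus M N)
  have "App (bar (Plus M N)) K \<rightarrow>v App (Plus (bar M) (bar N)) K"
    unfolding bar.simps using Plus.prems by (intro red_v_beta) simp_all
  also have "App (Plus (bar M) (bar N)) K \<rightarrow>v Plus (App (bar M) K) (App (bar N) K)"
    using Plus.prems by (intro red_v_Al rule_Al.intros is_value.intros)
  also have "Plus (App (bar M) K) (App (bar N) K) \<rightarrow>v Plus (colon_v M K) (colon_v N K)"
    by (intro red_v_Plus Plus)
  finally show ?case by simp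
qed

text \<open>A call-by-name step with arbitrary \<open>N\<close> becomes a call-by-value step because
  \<open>bar N\<close> is a base term.\<close>

lemma colon_v_beta:
  assumes "is_base K"
  shows "colon_v (App (Lam P) N) K \<rightarrow>v colon_v (subst P 0 N) K"
proof -
  have "colon_v (App (Lam P) N) K \<rightarrow>v App (bar (subst P 0 N)) K"
    by (auto simp: bar_subst intro!: red_v_App red_v_beta is_base_bar)
  also have "App (bar (subst P 0 N)) K \<rightarrow>v colon_v (subst P 0 N) K"
    using assms by (rule bar_colon_v)
  finally show ?thesis .
qed

definition sim_v :: "'s::{ring,monoid_mult} trm \<Rightarrow> 's trm \<Rightarrow> bool" where
  "sim_v M M' \<longleftrightarrow> (\<forall>K. is_base K \<longrightarrow> colon_v M K \<rightarrow>v colon_v M' K) \<and>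
     (\<forall>N K. is_base K \<longrightarrow> colon_v_app M N K \<rightarrow>v colon_v_app M' N K)"

lemma sim_v_App:
  assumes "\<And>K. is_base K \<Longrightarrow> colon_v (App M N) K \<rightarrow>v colon_v M' K"
  shows "sim_v (App M N) M'"
  unfolding sim_v_def
proof (intro conjI allI impI)
  fix L K
  have "colon_v (App M N) (app_cont L K) \<rightarrow>v colon_v M' (app_cont L K)"
    by (intro assms is_base.intros)
  also have "colon_v M' (app_cont L K) \<rightarrow>v colon_v_app M' L K"
    by (rule colon_v_app_cont)
  finally show "colon_v_app (App M N) L K \<rightarrow>v colon_v_app M' L K"
    by simp
qed (rule assms)

lemma sim_v_rule:
  assumes "(M, M') \<in> rule_A \<union> rule_L \<union> rule_beta_n"
  shows "sim_v M M'"
  using assms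
proof (elim UnE)
  assume "(M, M') \<in> rule_L"
  then show ?thesis
    unfolding sim_v_def
    by (auto intro!: red_v_L rule_L_linear[where f = "\<lambda>M. colon_v M K" for K]
        rule_L_linear[where f = "\<lambda>M. colon_v_app M N K" for N K])
next
  assume "(M, M') \<in> rule_beta_n"
  then show ?thesis by (auto elim!: rule_beta_n.cases intro!: sim_v_App colon_v_beta)
qed (auto elim!: rule_A.cases intro!: sim_v_App)

lemma sim_v_ctx:
  assumes "(M, M') \<in> ctx_xi R" "\<And>M M'. (M, M') \<in> R \<Longrightarrow> sim_v M M'"
  shows "sim_v M M'"
  using assms(1)
proof induction
  case (2 M M' N)
  then show ?case by (intro sim_v_App) (auto simp: sim_v_def)
qed (auto simp: assms(2), auto simp: sim_v_def intro: red_v_Scal red_v_Plus)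

lemma colon_v_red:
  assumes "M \<rightarrow>n N" "is_base K"
  shows "colon_v M K \<rightarrow>v colon_v N K"
  using assms(1)
proof induction
  case (step N L)
  from step(2) have "sim_v N L"
    unfolding red_a_beta_def red_a_def red_beta_n_def
    by (rule UnE) (erule sim_v_ctx, blast intro: sim_v_rule)+
  then have "colon_v N K \<rightarrow>v colon_v L K"
    using assms(2) by (simp add: sim_v_def)
  with step(3) show ?case by (rule rtrancl_trans)
qed simp

text \<open>For a variable nothing reduces: \<open>x : \<lambda>y y\<close> is already
  \<open>Phi x\<close>.\<close>

lemma colon_v_value:
  assumes "is_value V"
  shows "colon_v V (Lam (Var 0)) \<rightarrow>v Phi V"
  using assms
proof induction
  case (2 B)
  then show ?case by (auto elim!: is_base.cases intro!: red_v_beta is_base.intros)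
qed (auto intro: red_v_Scal red_v_Plus)

theorem theorem10:
  fixes M V :: "'s::{ring,monoid_mult} trm"
  assumes "closed_trm M" and "is_value V"
  shows "((M, V) \<in> red_l_beta\<^sup>* \<longrightarrow>
            (App (tilde M) (Lam (Var 0)), Psi V) \<in> red_a_beta_eq\<^sup>*) \<and>
         ((M, V) \<in> red_a_beta\<^sup>* \<longrightarrow>
            (App (bar M) (Lam (Var 0)), Phi V) \<in> red_l_beta_eq\<^sup>*)"
proof (intro conjI impI)
  assume "(M, V) \<in> red_l_beta\<^sup>*"
  then have "App (tilde M) (Lam (Var 0)) \<rightarrow>n Psi V"
    using tilde_colon_n colon_n_red colon_n_value[OF assms(2)] by (meson rtrancl_trans)
  moreover have "red_a_beta \<subseteq> (red_a_beta_eq :: ('s trm \<times> 's trm) set)"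
    by (auto simp: red_a_beta_def red_a_beta_eq_def)
  ultimately show "(App (tilde M) (Lam (Var 0)), Psi V) \<in> red_a_beta_eq\<^sup>*"
    using rtrancl_mono by blast
next
  assume "(M, V) \<in> red_a_beta\<^sup>*"
  then have "App (bar M) (Lam (Var 0)) \<rightarrow>v Phi V"
    using bar_colon_v colon_v_red colon_v_value[OF assms(2)]
    by (meson is_base.intros rtrancl_trans)
  moreover have "red_l_beta \<subseteq> (red_l_beta_eq :: ('s trm \<times> 's trm) set)"
    by (auto simp: red_l_beta_def red_l_beta_eq_def)
  ultimately show "(App (bar M) (Lam (Var 0)), Phi V) \<in> red_l_beta_eq\<^sup>*"
    using rtrancl_mono by blast
qed

end
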